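(* Let $\beta,\gamma$ be non-negative integers with $(\beta,\gamma)\neq(0,0)$, and let $H_n(\beta,\gamma)$ denote the coefficient of $\frac{x^n}{n!}$ in $\frac{e^{\gamma x}}{2-e^{\beta x}}$. Then for every $n\in\mathbb{N}_0$, $H_n(\beta,\gamma)$ equals the number of barred preferential arrangements of $X_n=\{1,\dots,n\}$ with exactly one bar, in which the first (left) section has the property that its elements are distributed into $\gamma$ labelled compartments (i.e. each element of that section is given a label from $\{1,\dots,\gamma\}$; the section may be empty), and the second (right) section is a preferential arrangement (ordered sequence of non-empty blocks, possibly no blocks) in which the elements of each block are distributed into $\beta$ labelled compartments (i.e. each element of the section is given a label from $\{1,\dots,\beta\}$).
   Context: A preferential arrangement of a finite set is an ordered set partition (a sequence of non-empty disjoint blocks whose union is the set). A barred preferential arrangement of $X_n$ with $\xi$ bars is obtained by placing $\xi$ identical bars, creating $\xi+1$ ordered sections, and distributing the elements of $X_n$ among the sections, each section carrying a (possibly empty) preferential arrangement of its elements. Convention $0^0=1$. *)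

theory Defs
  imports
    "HOL-Computational_Algebra.Formal_Power_Series"
    "HOL-Library.FuncSet"
begin

text \<open>The coefficient of \<open>x^n / n!\<close> in \<open>e^(\<gamma> x) / (2 - e^(\<beta> x))\<close>; the denominator has constant
  term 1, so the quotient is that of invertible formal power series.\<close>

definition H :: "nat \<Rightarrow> nat \<Rightarrow> nat \<Rightarrow> real" where
  "H n \<beta> \<gamma> = fact n * fps_nth (fps_exp (real \<gamma>) / (2 - fps_exp (real \<beta>))) n"

text \<open>Disjointness is required between positions, not between distinct values, so a non-empty set
  cannot occur twice in the list, whereas the empty set may.\<close>

definition pairwise_disjoint :: "'a set list \<Rightarrow> bool" where
  "pairwise_disjoint As \<longleftrightarrow>
     (\<forall>i<length As. \<forall>j<length As. i \<noteq> j \<longrightarrow> As ! i \<inter> As ! j = {})"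

definition pref_arrangements :: "'a set \<Rightarrow> 'a set list set" where
  "pref_arrangements A =
     {Bs. {} \<notin> set Bs \<and> pairwise_disjoint Bs \<and> \<Union> (set Bs) = A}"

text \<open>\<open>\<xi>\<close> bars create \<open>\<xi> + 1\<close> ordered sections. This is the distribution of the elements of \<open>X\<close> among
  the sections, without the structure carried by each of them.\<close>

definition bar_distributions :: "nat \<Rightarrow> 'a set \<Rightarrow> 'a set list set" where
  "bar_distributions \<xi> X =
     {Ss. length Ss = \<xi> + 1 \<and> pairwise_disjoint Ss \<and> \<Union> (set Ss) = X}"

text \<open>A distribution of the elements of \<open>A\<close> into \<open>k\<close> labelled (possibly empty) compartments.
  For \<open>k = 0\<close> one exists only if \<open>A\<close> is empty, and then exactly one.\<close>

definition compartment_labellings :: "nat \<Rightarrow> 'a set \<Rightarrow> ('a \<Rightarrow> nat) set" where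
  "compartment_labellings k A = A \<rightarrow>\<^sub>E {1..k}"

text \<open>An arrangement consists of the two sections \<open>Ss\<close>, the compartments \<open>f\<close> of the left section,
  the block sequence \<open>Bs\<close> of the right section, and the compartments \<open>g\<close> of its blocks.
  The left section carries no order besides its compartments. As the blocks are disjoint, one
  labelling \<open>g\<close> of the whole right section is the same as one labelling for each block.\<close>

definition one_bar_arrangements ::
    "nat \<Rightarrow> nat \<Rightarrow> 'a set \<Rightarrow> ('a set list \<times> ('a \<Rightarrow> nat) \<times> 'a set list \<times> ('a \<Rightarrow> nat)) set" where
  "one_bar_arrangements \<beta> \<gamma> X =
     {(Ss, f, Bs, g).
        Ss \<in> bar_distributions 1 X \<and>
        f \<in> compartment_labellings \<gamma> (Ss ! 0) \<and>
        Bs \<in> pref_arrangements (Ss ! 1) \<and>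
        g \<in> compartment_labellings \<beta> (Ss ! 1)}"

end

theory Submission
  imports Defs
begin

text \<open>Let \<open>a\<close> be the sequence of Fubini numbers. Splitting off the first block of a preferential
  arrangement gives the recurrence of \<open>a\<close>, which says that the series \<open>F = \<Sum> a\<^sub>n (\<beta> x)^n / n!\<close> satisfies
  \<open>2 F = 1 + F e^(\<beta> x)\<close>. Sorting the arrangements with one bar by their left section gives the
  binomial convolution of \<open>\<gamma>^k\<close> with \<open>\<beta>^k a\<^sub>k\<close>, whose generating function is
  \<open>e^(\<gamma> x) F\<close>.\<close>

lemma sum_Pow_card:
  fixes f :: "nat \<Rightarrow> 'b :: comm_semiring_1"
  assumes "finite A"
  shows "(\<Sum>S\<in>Pow A. f (card S)) = (\<Sum>k\<le>card A. of_nat (card A choose k) * f k)"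
proof -
  have "(\<Sum>S\<in>Pow A. f (card S)) = (\<Sum>k\<le>card A. \<Sum>S | S \<in> Pow A \<and> card S = k. f (card S))"
    using assms by (intro sum.group [symmetric]) (auto intro: card_mono)
  also have "\<dots> = (\<Sum>k\<le>card A. of_nat (card A choose k) * f k)"
    using assms by (intro sum.cong refl) (simp add: n_subsets)
  finally show ?thesis .
qed

lemma sum_Pow_Diff:
  "(\<Sum>S\<in>Pow A. f (A - S)) = (\<Sum>S\<in>Pow A. f S)"
  by (rule sum.reindex_bij_witness [of _ "\<lambda>S. A - S" "\<lambda>S. A - S"]) auto

text \<open>\<open>k\<close> is the number of elements outside the first block; that block is
  non-empty, hence \<open>k < n\<close>.\<close>

fun fubini :: "nat \<Rightarrow> nat" where
  "fubini n = (if n = 0 then 1 else \<Sum>k<n. (n choose k) * fubini k)"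

declare fubini.simps [simp del]

lemma fubini_0 [simp]: "fubini 0 = 1"
  by (simp add: fubini.simps)

text \<open>The terms with \<open>k < n\<close> add up to \<open>fubini n\<close> by the recurrence,
  and the term \<open>k = n\<close> is a second copy. At \<open>n = 0\<close> the sum is 1 instead
  of 2.\<close>

lemma sum_choose_fubini:
  assumes "n > 0"
  shows "(\<Sum>k\<le>n. (n choose k) * fubini k) = 2 * fubini n"
  using assms fubini.simps [of n] by (simp flip: lessThan_Suc_atMost)

text \<open>Complementation turns the sum over all \<open>B\<close> into a binomial sum equal to
  twice \<open>fubini (card A)\<close>; dropping \<open>B = {}\<close> removes one copy.\<close>

lemma sum_nonempty_subsets_fubini:
  assumes "finite A" "A \<noteq> {}"
  shows "(\<Sum>B\<in>Pow A - {{}}. fubini (card (A - B))) = fubini (card A)"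
proof -
  have "(\<Sum>B\<in>Pow A. fubini (card (A - B))) = 2 * fubini (card A)"
    using assms
    by (simp add: sum_Pow_Diff [of "\<lambda>S. fubini (card S)"] sum_Pow_card sum_choose_fubini card_gt_0_iff)
  moreover have "(\<Sum>B\<in>Pow A. fubini (card (A - B)))
      = fubini (card A) + (\<Sum>B\<in>Pow A - {{}}. fubini (card (A - B)))"
    using assms by (subst sum.remove [of _ "{}"]) auto
  ultimately show ?thesis
    by simp
qed

lemma pairwise_disjoint_Nil [simp]: "pairwise_disjoint []"
  by (simp add: pairwise_disjoint_def)

lemma pairwise_disjoint_Cons [simp]:
  "pairwise_disjoint (B # Bs) \<longleftrightarrow> B \<inter> \<Union> (set Bs) = {} \<and> pairwise_disjoint Bs"
proof -
  have "B \<inter> \<Union> (set Bs) = {} \<longleftrightarrow> (\<forall>i<length Bs. B \<inter> Bs ! i = {})"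
    by (fastforce simp: set_conv_nth)
  then show ?thesis
    unfolding pairwise_disjoint_def
    by (simp add: All_less_Suc2 Int_commute) blast
qed

lemma pref_arrangements_empty: "pref_arrangements {} = {[]}"
proof -
  have "Bs = []" if "{} \<notin> set Bs" "\<Union> (set Bs) = {}" for Bs :: "'a set list"
    using that by (cases Bs) auto
  then show ?thesis
    \<comment> \<open>\<open>Sup_bot_conv\<close> would break up the equation on the union, which
      has to match the premise of the fact above.\<close>
    by (auto simp: pref_arrangements_def simp del: Sup_bot_conv)
qed

lemma pref_arrangements_nonempty:
  assumes "A \<noteq> {}"
  shows "pref_arrangements A =
    (\<lambda>(B, Bs). B # Bs) ` (SIGMA B : Pow A - {{}}. pref_arrangements (A - B))"
proof (intro equalityI subsetI)
  fix Cs assume Cs: "Cs \<in> pref_arrangements A"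
  with assms obtain B Bs where "Cs = B # Bs"
    by (cases Cs) (auto simp: pref_arrangements_def)
  with Cs show "Cs \<in> (\<lambda>(B, Bs). B # Bs) ` (SIGMA B : Pow A - {{}}. pref_arrangements (A - B))"
    by (intro image_eqI [of _ _ "(B, Bs)"]) (auto simp: pref_arrangements_def)
next
  fix Cs assume "Cs \<in> (\<lambda>(B, Bs). B # Bs) ` (SIGMA B : Pow A - {{}}. pref_arrangements (A - B))"
  then obtain B Bs where "Cs = B # Bs" "B \<subseteq> A" "B \<noteq> {}" "Bs \<in> pref_arrangements (A - B)"
    by auto
  then show "Cs \<in> pref_arrangements A"
    by (simp add: pref_arrangements_def) blast
qed

text \<open>Removing a non-empty first block leaves a proper subset, to which the induction
  hypothesis applies. Finiteness is carried along because \<open>card_SigmaI\<close> needs finite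
  fibres.\<close>

lemma finite_card_pref_arrangements:
  assumes "finite A"
  shows "finite (pref_arrangements A) \<and> card (pref_arrangements A) = fubini (card A)"
  using assms
proof (induction A rule: finite_psubset_induct)
  case (psubset A)
  show ?case
  proof (cases "A = {}")
    case True
    then show ?thesis by (simp add: pref_arrangements_empty)
  next
    case False
    let ?S = "SIGMA B : Pow A - {{}}. pref_arrangements (A - B)"
    have IH: "finite (pref_arrangements (A - B)) \<and>
        card (pref_arrangements (A - B)) = fubini (card (A - B))" if "B \<in> Pow A - {{}}" for B
      using that by (intro psubset.IH) auto
    have "finite ?S"
      using IH psubset.hyps by (intro finite_SigmaI) auto
    moreover have "card ?S = (\<Sum>B\<in>Pow A - {{}}. fubini (card (A - B)))"
      using IH psubset.hyps by (subst card_SigmaI) auto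
    moreover have "inj_on (\<lambda>(B, Bs). B # Bs) ?S"
      by (auto simp: inj_on_def)
    ultimately show ?thesis
      using psubset.hyps False
      by (simp add: pref_arrangements_nonempty card_image sum_nonempty_subsets_fubini)
  qed
qed

text \<open>With two sections, the right one determines the left as its complement.\<close>

lemma bar_distributions_1: "bar_distributions 1 X = (\<lambda>S. [X - S, S]) ` Pow X"
  unfolding bar_distributions_def
  by (auto simp: length_Suc_conv numeral_2_eq_2 image_iff)

lemma card_one_bar_arrangements:
  assumes "finite X"
  shows "card (one_bar_arrangements \<beta> \<gamma> X) =
    (\<Sum>k\<le>card X. (card X choose k) * (\<gamma> ^ (card X - k) * (fubini k * \<beta> ^ k)))"
proof -
  let ?T = "\<lambda>S. compartment_labellings \<gamma> (X - S) \<times> pref_arrangements S \<times> compartment_labellings \<beta> S"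
  have "one_bar_arrangements \<beta> \<gamma> X = (\<lambda>(S, t). ([X - S, S], t)) ` (SIGMA S : Pow X. ?T S)"
    unfolding one_bar_arrangements_def bar_distributions_1 by force
  \<comment> \<open>\<open>S\<close> can be read off as the second entry of the list.\<close>
  moreover have "inj_on (\<lambda>(S, t). ([X - S, S], t)) (SIGMA S : Pow X. ?T S)"
    by (auto simp: inj_on_def)
  ultimately have "card (one_bar_arrangements \<beta> \<gamma> X) = card (SIGMA S : Pow X. ?T S)"
    by (simp add: card_image)
  also have "\<dots> = (\<Sum>S\<in>Pow X. card (?T S))"
    using assms finite_subset [OF _ assms]
    by (intro card_SigmaI)
      (auto simp: compartment_labellings_def finite_card_pref_arrangements intro!: finite_cartesian_product finite_PiE)
  \<comment> \<open>An empty section has exactly one labelling, even with no compartments, in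
    agreement with \<open>0 ^ 0 = 1\<close>.\<close>
  also have "\<dots> = (\<Sum>S\<in>Pow X. \<gamma> ^ (card X - card S) * (fubini (card S) * \<beta> ^ card S))"
    using assms finite_subset [OF _ assms]
    by (intro sum.cong refl)
      (auto simp: compartment_labellings_def card_cartesian_product card_PiE
        finite_card_pref_arrangements card_Diff_subset)
  finally show ?thesis
    using assms sum_Pow_card [of X "\<lambda>k. \<gamma> ^ (card X - k) * (fubini k * \<beta> ^ k)"] by simp
qed

text \<open>Exponential generating functions multiply by binomial convolution, as
  \<open>n choose k\<close> over \<open>n!\<close> is the reciprocal of
  \<open>k! (n - k)!\<close>.\<close>

lemma fps_nth_mult_egf:
  fixes a b :: "nat \<Rightarrow> 'a :: field_char_0"
  shows "fps_nth (Abs_fps (\<lambda>k. a k / fact k) * Abs_fps (\<lambda>k. b k / fact k)) n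
    = (\<Sum>k\<le>n. of_nat (n choose k) * (a k * b (n - k))) / fact n"
  by (simp add: fps_mult_nth atLeast0AtMost sum_divide_distrib binomial_fact)

lemma fps_exp_egf: "fps_exp c = Abs_fps (\<lambda>k. c ^ k / fact k)"
  by (simp add: fps_exp_def)

lemma fubini_egf:
  fixes c :: "'a :: field_char_0"
  shows "Abs_fps (\<lambda>k. of_nat (fubini k) * c ^ k / fact k) * (2 - fps_exp c) = 1"
    (is "?F * _ = 1")
proof -
  have "?F * fps_exp c = 2 * ?F - 1"
  proof (rule fps_ext)
    fix n
    have "fps_nth (?F * fps_exp c) n
        = (\<Sum>k\<le>n. of_nat (n choose k) * (of_nat (fubini k) * c ^ k * c ^ (n - k))) / fact n"
      unfolding fps_exp_egf by (rule fps_nth_mult_egf)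
    also have "\<dots> = of_nat (\<Sum>k\<le>n. (n choose k) * fubini k) * c ^ n / fact n"
      by (simp add: sum_distrib_right mult.assoc flip: power_add)
    \<comment> \<open>The summand \<open>- 1\<close> corrects the constant term, where the Fubini
      sum is not doubled. Keeping \<open>of_nat\<close> outside the sum lets
      \<open>sum_choose_fubini\<close> apply for \<open>n > 0\<close>.\<close>
    also have "\<dots> = fps_nth (2 * ?F - 1) n"
      by (cases "n = 0") (simp_all add: sum_choose_fubini numeral_fps_const del: of_nat_sum)
    finally show "fps_nth (?F * fps_exp c) n = fps_nth (2 * ?F - 1) n" .
  qed
  then show ?thesis
    by (simp add: algebra_simps)
qed

theorem theorem2:
  fixes \<beta> \<gamma> n :: nat
  assumes "(\<beta>, \<gamma>) \<noteq> (0, 0)"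
  shows "H n \<beta> \<gamma> = real (card (one_bar_arrangements \<beta> \<gamma> {1..n}))"
proof -
  let ?F = "Abs_fps (\<lambda>k. real (fubini k) * real \<beta> ^ k / fact k)"
  let ?D = "2 - fps_exp (real \<beta>)"
  have F: "?F * ?D = 1"
    by (rule fubini_egf)
  then have "?D \<noteq> 0"
    by auto
  \<comment> \<open>Inserting the factor \<open>?F * ?D = 1\<close> exhibits the numerator as a
    multiple of \<open>?D\<close>, so that the quotient cancels.\<close>
  moreover have "fps_exp (real \<gamma>) = ?F * fps_exp (real \<gamma>) * ?D"
    using F by (simp add: mult_ac)
  ultimately have "fps_exp (real \<gamma>) / ?D = ?F * fps_exp (real \<gamma>)"
    by (metis nonzero_mult_div_cancel_right)
  then have "H n \<beta> \<gamma> = fact n * fps_nth (?F * fps_exp (real \<gamma>)) n"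
    by (simp add: H_def)
  also have "\<dots> = (\<Sum>k\<le>n. real (n choose k) * (real (fubini k) * real \<beta> ^ k * real \<gamma> ^ (n - k)))"
    unfolding fps_exp_egf [of "real \<gamma>"] fps_nth_mult_egf by simp
  also have "\<dots> = real (card (one_bar_arrangements \<beta> \<gamma> {1..n}))"
    by (simp add: card_one_bar_arrangements mult_ac)
  finally show ?thesis .
qed

end
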